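(* Let $\lambda,\mu,\theta,c>0$ be constants and let $q:[0,\infty)\to\mathbb{R}$, with $q(0)\ge 0$, be the solution of the ordinary differential equation $$\dot q(t)=\lambda-\mu\,(q(t)\wedge c)-\theta\,(q(t)-c)^+ .$$ Define, when $q(0)>c$ and $\lambda\le\mu c$, $$t_1^*=\frac{1}{\theta}\log\left(\frac{\theta q(0)-\lambda+\mu c-\theta c}{\mu c-\lambda}\right),$$ and, when $q(0)\le c$ and $\lambda>\mu c$, $$t_2^*=\frac{1}{\mu}\log\left(\frac{q(0)-\frac{\lambda}{\mu}}{c-\frac{\lambda}{\mu}}\right).$$ Then for all $t\ge 0$, $$q(t)=\begin{cases} \frac{\lambda-\mu c+\theta c}{\theta}+\left(q(0)-\frac{\lambda-\mu c+\theta c}{\theta}\right)e^{-\theta t}, & \text{if } q(0)>c,\ \lambda>\mu c,\\ \frac{\lambda-\mu c+\theta c}{\theta}+\left(q(0)-\frac{\lambda-\mu c+\theta c}{\theta}\right)e^{-\theta t}, & \text{if } q(0)>c,\ \lambda\le\mu c,\ t\le t_1^*,\\ \frac{\lambda}{\mu}+\left(c-\frac{\lambda}{\mu}\right)e^{-\mu(t-t_1^* )}, & \text{if } q(0)>c,\ \lambda\le\mu c,\ t>t_1^*,\\ \frac{\lambda}{\mu}+\left(q(0)-\frac{\lambda}{\mu}\right)e^{-\mu t}, & \text{if } q(0)\le c,\ \lambda\le\mu c,\\ \frac{\lambda}{\mu}+\left(q(0)-\frac{\lambda}{\mu}\right)e^{-\mu t}, & \text{if } q(0)\le c,\ \lambda>\mu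 c,\ t\le t_2^*,\\ \frac{\lambda-\mu c+\theta c}{\theta}+\left(\frac{-\lambda+\mu c}{\theta}\right)e^{-\theta(t-t_2^* )}, & \text{if } q(0)\le c,\ \lambda>\mu c,\ t>t_2^* . \end{cases}$$
   Context: Here $x\wedge y=\min\{x,y\}$ and $x^+=\max\{x,0\}$. The equation is the fluid limit equation of the Erlang-A queue with arrival rate $\lambda$, service rate $\mu$, abandonment rate $\theta$ and $c$ servers. Convention: when $\lambda=\mu c$ and $q(0)>c$, the argument of the logarithm in $t_1^*$ is read as $+\infty$, so $t_1^*=+\infty$. *)

theory Defs
  imports "HOL-Analysis.Analysis"
begin

definition erlangA_drift :: "real \<Rightarrow> real \<Rightarrow> real \<Rightarrow> real \<Rightarrow> real \<Rightarrow> real" where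
  "erlangA_drift lam \<mu> \<theta> c x = lam - \<mu> * min x c - \<theta> * max (x - c) 0"

text \<open>Only the values on the half-line are relevant, so the derivative is taken within it; at time 0
  it is the right derivative.\<close>

definition erlangA_fluid_solution ::
  "real \<Rightarrow> real \<Rightarrow> real \<Rightarrow> real \<Rightarrow> (real \<Rightarrow> real) \<Rightarrow> bool" where
  "erlangA_fluid_solution lam \<mu> \<theta> c q \<longleftrightarrow>
     (\<forall>t\<ge>0. (q has_real_derivative erlangA_drift lam \<mu> \<theta> c (q t)) (at t within {0..}))"

text \<open>Meaningful when \<open>q0 > c\<close> and \<open>lam \<le> \<mu> * c\<close>. At critical loading \<open>lam = \<mu> * c\<close> the
  argument of the logarithm has denominator 0 and is read as \<open>\<infinity>\<close>; hence the type ereal.\<close>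

definition t1_star :: "real \<Rightarrow> real \<Rightarrow> real \<Rightarrow> real \<Rightarrow> real \<Rightarrow> ereal" where
  "t1_star lam \<mu> \<theta> c q0 =
     (if lam = \<mu> * c then \<infinity>
      else ereal (1 / \<theta> * ln ((\<theta> * q0 - lam + \<mu> * c - \<theta> * c) / (\<mu> * c - lam))))"

text \<open>Meaningful when \<open>q0 \<le> c\<close> and \<open>lam > \<mu> * c\<close>.\<close>

definition t2_star :: "real \<Rightarrow> real \<Rightarrow> real \<Rightarrow> real \<Rightarrow> real" where
  "t2_star lam \<mu> c q0 = 1 / \<mu> * ln ((q0 - lam / \<mu>) / (c - lam / \<mu>))"

end

theory Submission
  imports Defs
begin

text \<open>The drift is nonincreasing in the state, so the squared distance between two solutions is
  nonincreasing and the equation has at most one solution forward in time. On each side of \<open>c\<close> the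
  drift is affine, so an exponential relaxation solves the equation as long as it stays on its
  side; being monotone in time, it does so as soon as both of its end points do. At \<open>t1_star\<close> and
  \<open>t2_star\<close> the relaxation started from \<open>q 0\<close> reaches \<open>c\<close>, where the second phase begins.\<close>

lemma antimono_ode_unique:
  fixes f p q :: "real \<Rightarrow> real"
  assumes "antimono f" and "a \<le> b" and "p a = q a"
    and p: "\<And>s. s \<in> {a..b} \<Longrightarrow> (p has_real_derivative f (p s)) (at s within {a..b})"
    and q: "\<And>s. s \<in> {a..b} \<Longrightarrow> (q has_real_derivative f (q s)) (at s within {a..b})"
  shows "p b = q b"
proof -
  define d where "d s = (p s - q s)\<^sup>2" for s
  have deriv: "(d has_real_derivative 2 * ((p s - q s) * (f (p s) - f (q s)))) (at s within {a..b})"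
    if "s \<in> {a..b}" for s
    unfolding d_def by (rule derivative_eq_intros p q that refl | simp add: algebra_simps)+
  have nonpos: "2 * ((p s - q s) * (f (p s) - f (q s))) \<le> 0" for s
  proof (cases "p s \<le> q s")
    case True
    with antimonoD[OF \<open>antimono f\<close> True] show ?thesis
      by (simp add: mult_nonpos_nonneg)
  next
    case False
    then have "f (p s) \<le> f (q s)"
      using antimonoD[OF \<open>antimono f\<close>, of "q s" "p s"] by simp
    with False show ?thesis
      by (simp add: mult_nonneg_nonpos)
  qed
  \<comment> \<open>The monotonicity criterion wants two-sided derivatives only in the open interval
    and continuity up to its ends, so the one-sided derivatives at \<open>a\<close> and
    \<open>b\<close> suffice.\<close>
  have "d b \<le> d a"
  proof (rule DERIV_nonpos_imp_decreasing_open[OF \<open>a \<le> b\<close>])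
    show "\<exists>y. DERIV d x :> y \<and> y \<le> 0" if "a < x" "x < b" for x
      using deriv[of x] nonpos[of x] that by (auto simp: at_within_Icc_at)
    show "continuous_on {a..b} d"
      by (rule DERIV_continuous_on[OF deriv])
  qed
  with \<open>p a = q a\<close> show ?thesis
    by (simp add: d_def)
qed

text \<open>The solution of x' = k (m - x) after elapsed time \<open>s\<close>: rate
  \<open>k\<close>, equilibrium \<open>m\<close>, starting value \<open>x\<close>.\<close>

definition relax :: "real \<Rightarrow> real \<Rightarrow> real \<Rightarrow> real \<Rightarrow> real" where
  "relax k m x s = m + (x - m) * exp (- k * s)"

lemma relax_0 [simp]: "relax k m x 0 = x"
  by (simp add: relax_def)

lemma relax_shift_deriv:
  "((\<lambda>s. relax k m x (s - a)) has_real_derivative k * (m - relax k m x (s - a))) (at s within S)"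
  unfolding relax_def by (rule derivative_eq_intros refl | simp add: algebra_simps)+

text \<open>The relaxation is monotone in time: for \<open>x \<ge> m\<close> it decreases and its
  value at \<open>u\<close> gives the bound, otherwise it increases and \<open>x\<close> gives
  it.\<close>

lemma relax_ge_between:
  assumes "k \<ge> 0" and "0 \<le> s" and "s \<le> u" and "y \<le> x" and "y \<le> relax k m x u"
  shows "y \<le> relax k m x s"
proof -
  have lo: "exp (- k * u) \<le> exp (- k * s)" and hi: "exp (- k * s) \<le> 1"
    using assms by (auto intro: mult_left_mono)
  show ?thesis
  proof (cases "x \<ge> m")
    case True
    with mult_left_mono[OF lo, of "x - m"] assms(5) show ?thesis
      by (simp add: relax_def)
  next
    case False
    with mult_left_mono[OF hi, of "m - x"] assms(4) show ?thesis
      by (simp add: relax_def algebra_simps)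
  qed
qed

lemma relax_le_between:
  assumes "k \<ge> 0" and "0 \<le> s" and "s \<le> u" and "x \<le> y" and "relax k m x u \<le> y"
  shows "relax k m x s \<le> y"
proof -
  \<comment> \<open>Reflection at 0 turns upper bounds into lower ones.\<close>
  have neg: "relax k (- m) (- x) r = - relax k m x r" for r
    by (simp add: relax_def algebra_simps)
  from relax_ge_between[of k s u "- y" "- x" "- m"] assms show ?thesis
    by (simp add: neg)
qed

text \<open>The value is a convex combination of \<open>x\<close> and \<open>m\<close> with weight
  \<open>exp (- k * s)\<close> on \<open>x\<close>. Unlike \<open>relax_ge_between\<close>, this
  serves phases that never end.\<close>

lemma relax_ge:
  assumes "k \<ge> 0" and "0 \<le> s" and "y \<le> x" and "y \<le> m"
  shows "y \<le> relax k m x s"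
proof -
  have "relax k m x s - y = (x - y) * exp (- k * s) + (m - y) * (1 - exp (- k * s))"
    by (simp add: relax_def algebra_simps)
  also have "\<dots> \<ge> 0"
    using assms by (intro add_nonneg_nonneg mult_nonneg_nonneg) auto
  finally show ?thesis
    by simp
qed

lemma relax_le:
  assumes "k \<ge> 0" and "0 \<le> s" and "x \<le> y" and "m \<le> y"
  shows "relax k m x s \<le> y"
  using relax_ge[of k s "- y" "- x" "- m"] assms by (simp add: relax_def algebra_simps)

text \<open>Solve for the elapsed time. A positive ratio lets \<open>exp\<close> undo
  \<open>ln\<close>, and it also excludes \<open>y = m\<close>, where division by zero would give
  0.\<close>

lemma relax_hit:
  assumes "k \<noteq> 0" and "(x - m) / (y - m) > 0"
  shows "relax k m x (1 / k * ln ((x - m) / (y - m))) = y"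
proof -
  have "exp (- k * (1 / k * ln ((x - m) / (y - m)))) = inverse ((x - m) / (y - m))"
    using assms by (simp add: exp_minus)
  then show ?thesis
    using assms(2) by (auto simp: relax_def)
qed

lemma antimono_erlangA_drift:
  assumes "\<mu> \<ge> 0" and "\<theta> \<ge> 0"
  shows "antimono (erlangA_drift lam \<mu> \<theta> c)"
proof (rule antimonoI)
  fix x y :: real
  assume "x \<le> y"
  then have "\<mu> * min x c \<le> \<mu> * min y c" and "\<theta> * max (x - c) 0 \<le> \<theta> * max (y - c) 0"
    using assms by (auto intro!: mult_left_mono)
  then show "erlangA_drift lam \<mu> \<theta> c y \<le> erlangA_drift lam \<mu> \<theta> c x"
    by (simp add: erlangA_drift_def)
qed

text \<open>The affine formulas for the two sides agree at \<open>c\<close>, so each may include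
  that boundary point.\<close>

lemma erlangA_drift_above:
  assumes "\<theta> \<noteq> 0" and "c \<le> x"
  shows "erlangA_drift lam \<mu> \<theta> c x = \<theta> * ((lam - \<mu> * c + \<theta> * c) / \<theta> - x)"
  using assms by (simp add: erlangA_drift_def field_simps)

lemma erlangA_drift_below:
  assumes "\<mu> \<noteq> 0" and "x \<le> c"
  shows "erlangA_drift lam \<mu> \<theta> c x = \<mu> * (lam / \<mu> - x)"
  using assms by (simp add: erlangA_drift_def field_simps)

text \<open>Uniqueness, applied to \<open>q\<close> and the relaxation restarted at time
  \<open>a\<close>. The drift is compared along the explicit relaxation, so nothing need be known
  about the path of \<open>q\<close> after \<open>a\<close>.\<close>

lemma erlangA_fluid_solution_eq_relax:
  assumes sol: "erlangA_fluid_solution lam \<mu> \<theta> c q"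
    and "\<mu> \<ge> 0" and "\<theta> \<ge> 0" and "0 \<le> a" and "a \<le> b"
    and drift: "\<And>s. s \<in> {a..b} \<Longrightarrow>
      erlangA_drift lam \<mu> \<theta> c (relax k m (q a) (s - a)) = k * (m - relax k m (q a) (s - a))"
  shows "q b = relax k m (q a) (b - a)"
proof (rule antimono_ode_unique[OF antimono_erlangA_drift[OF \<open>\<mu> \<ge> 0\<close> \<open>\<theta> \<ge> 0\<close>] \<open>a \<le> b\<close>])
  show "q a = relax k m (q a) (a - a)"
    by simp
next
  fix s
  assume s: "s \<in> {a..b}"
  show "(q has_real_derivative erlangA_drift lam \<mu> \<theta> c (q s)) (at s within {a..b})"
    by (rule DERIV_subset[of _ _ _ "{0..}"])
      (use sol s \<open>0 \<le> a\<close> in \<open>auto simp: erlangA_fluid_solution_def\<close>)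
  show "((\<lambda>s. relax k m (q a) (s - a)) has_real_derivative
      erlangA_drift lam \<mu> \<theta> c (relax k m (q a) (s - a))) (at s within {a..b})"
    unfolding drift[OF s] by (rule relax_shift_deriv)
qed

lemma erlangA_fluid_solution_above:
  fixes lam \<mu> \<theta> c :: real
  defines "m \<equiv> (lam - \<mu> * c + \<theta> * c) / \<theta>"
  assumes "erlangA_fluid_solution lam \<mu> \<theta> c q"
    and "\<mu> \<ge> 0" and "\<theta> > 0" and "0 \<le> a" and "a \<le> b"
    and "c \<le> q a" and "c \<le> relax \<theta> m (q a) (b - a)"
  shows "q b = relax \<theta> m (q a) (b - a)"
proof (rule erlangA_fluid_solution_eq_relax)
  fix s
  assume "s \<in> {a..b}"
  then have "c \<le> relax \<theta> m (q a) (s - a)"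
    using assms by (intro relax_ge_between[of \<theta> "s - a" "b - a"]) auto
  then show "erlangA_drift lam \<mu> \<theta> c (relax \<theta> m (q a) (s - a)) = \<theta> * (m - relax \<theta> m (q a) (s - a))"
    using \<open>\<theta> > 0\<close> unfolding m_def by (intro erlangA_drift_above) auto
qed (use assms in auto)

lemma erlangA_fluid_solution_below:
  fixes lam \<mu> \<theta> c :: real
  defines "m \<equiv> lam / \<mu>"
  assumes "erlangA_fluid_solution lam \<mu> \<theta> c q"
    and "\<mu> > 0" and "\<theta> \<ge> 0" and "0 \<le> a" and "a \<le> b"
    and "q a \<le> c" and "relax \<mu> m (q a) (b - a) \<le> c"
  shows "q b = relax \<mu> m (q a) (b - a)"
proof (rule erlangA_fluid_solution_eq_relax)
  fix s
  assume "s \<in> {a..b}"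
  then have "relax \<mu> m (q a) (s - a) \<le> c"
    using assms by (intro relax_le_between[of \<mu> "s - a" "b - a"]) auto
  then show "erlangA_drift lam \<mu> \<theta> c (relax \<mu> m (q a) (s - a)) = \<mu> * (m - relax \<mu> m (q a) (s - a))"
    using \<open>\<mu> > 0\<close> unfolding m_def by (intro erlangA_drift_below) auto
qed (use assms in auto)

theorem proposition2p2:
  fixes lam \<mu> \<theta> c :: real and q :: "real \<Rightarrow> real" and t :: real
  assumes "lam > 0" and "\<mu> > 0" and "\<theta> > 0" and "c > 0"
    and "q 0 \<ge> 0"
    and "erlangA_fluid_solution lam \<mu> \<theta> c q"
    and "t \<ge> 0"
  shows
    "(q 0 > c \<and> lam > \<mu> * c \<longrightarrow>
        q t = (lam - \<mu> * c + \<theta> * c) / \<theta>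
            + (q 0 - (lam - \<mu> * c + \<theta> * c) / \<theta>) * exp (- \<theta> * t)) \<and>
     (q 0 > c \<and> lam \<le> \<mu> * c \<and> ereal t \<le> t1_star lam \<mu> \<theta> c (q 0) \<longrightarrow>
        q t = (lam - \<mu> * c + \<theta> * c) / \<theta>
            + (q 0 - (lam - \<mu> * c + \<theta> * c) / \<theta>) * exp (- \<theta> * t)) \<and>
     (q 0 > c \<and> lam \<le> \<mu> * c \<and> ereal t > t1_star lam \<mu> \<theta> c (q 0) \<longrightarrow>
        q t = lam / \<mu>
            + (c - lam / \<mu>) * exp (- \<mu> * (t - real_of_ereal (t1_star lam \<mu> \<theta> c (q 0))))) \<and>
     (q 0 \<le> c \<and> lam \<le> \<mu> * c \<longrightarrow>
        q t = lam / \<mu> + (q 0 - lam / \<mu>) * exp (- \<mu> * t)) \<and>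
     (q 0 \<le> c \<and> lam > \<mu> * c \<and> t \<le> t2_star lam \<mu> c (q 0) \<longrightarrow>
        q t = lam / \<mu> + (q 0 - lam / \<mu>) * exp (- \<mu> * t)) \<and>
     (q 0 \<le> c \<and> lam > \<mu> * c \<and> t > t2_star lam \<mu> c (q 0) \<longrightarrow>
        q t = (lam - \<mu> * c + \<theta> * c) / \<theta>
            + ((- lam + \<mu> * c) / \<theta>) * exp (- \<theta> * (t - t2_star lam \<mu> c (q 0))))"
proof -
  \<comment> \<open>\<open>m1\<close> and \<open>m0\<close> are the equilibria of the affine drifts
    above and below \<open>c\<close>; the sign of \<open>lam - \<mu> * c\<close> decides on which
    side of \<open>c\<close> they lie.\<close>
  define m1 where "m1 = (lam - \<mu> * c + \<theta> * c) / \<theta>"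
  define m0 where "m0 = lam / \<mu>"
  note above = erlangA_fluid_solution_above[OF \<open>erlangA_fluid_solution lam \<mu> \<theta> c q\<close>
      less_imp_le[OF \<open>\<mu> > 0\<close>] \<open>\<theta> > 0\<close>, folded m1_def]
  note below = erlangA_fluid_solution_below[OF \<open>erlangA_fluid_solution lam \<mu> \<theta> c q\<close>
      \<open>\<mu> > 0\<close> less_imp_le[OF \<open>\<theta> > 0\<close>], folded m0_def]
  have m1_less: "m1 < c \<longleftrightarrow> lam < \<mu> * c" and m1_ge: "c \<le> m1 \<longleftrightarrow> \<mu> * c \<le> lam"
    and m0_less: "c < m0 \<longleftrightarrow> \<mu> * c < lam" and m0_le: "m0 \<le> c \<longleftrightarrow> lam \<le> \<mu> * c"
    using \<open>\<mu> > 0\<close> \<open>\<theta> > 0\<close> by (auto simp: m1_def m0_def field_simps)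

  \<comment> \<open>Critical loading is included: then \<open>m1 = c\<close>, and the relaxation
    stays above \<open>c\<close> for all time.\<close>
  have above_forever: "q t = relax \<theta> m1 (q 0) t" if "c < q 0" "\<mu> * c \<le> lam"
    using above[of 0 t] relax_ge[of \<theta> t c "q 0" m1] that \<open>t \<ge> 0\<close> \<open>\<theta> > 0\<close> by (simp add: m1_ge)
  have below_forever: "q t = relax \<mu> m0 (q 0) t" if "q 0 \<le> c" "lam \<le> \<mu> * c"
    using below[of 0 t] relax_le[of \<mu> t "q 0" c m0] that \<open>t \<ge> 0\<close> \<open>\<mu> > 0\<close> by (simp add: m0_le)

  have down: "(ereal t \<le> t1_star lam \<mu> \<theta> c (q 0) \<longrightarrow> q t = relax \<theta> m1 (q 0) t) \<and>
      (ereal t > t1_star lam \<mu> \<theta> c (q 0) \<longrightarrow>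
        q t = relax \<mu> m0 c (t - real_of_ereal (t1_star lam \<mu> \<theta> c (q 0))))"
    if "c < q 0" "lam < \<mu> * c"
  proof -
    define T where "T = 1 / \<theta> * ln ((q 0 - m1) / (c - m1))"
    \<comment> \<open>Numerator and denominator are \<open>\<theta>\<close> times
      \<open>q 0 - m1\<close> and \<open>c - m1\<close>.\<close>
    have "(\<theta> * q 0 - lam + \<mu> * c - \<theta> * c) / (\<mu> * c - lam) = (q 0 - m1) / (c - m1)"
      using \<open>\<theta> > 0\<close> that by (simp add: m1_def divide_simps)
    then have T: "t1_star lam \<mu> \<theta> c (q 0) = ereal T"
      using that by (simp add: t1_star_def T_def)
    have "m1 < c"
      using that by (simp add: m1_less)
    \<comment> \<open>The start is at least as far from the equilibrium as \<open>c\<close> is. This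
      gives both \<open>T \<ge> 0\<close> and the positivity that \<open>relax_hit\<close> asks
      for.\<close>
    then have ge_1: "1 \<le> (q 0 - m1) / (c - m1)"
      using that by simp
    then have "T \<ge> 0"
      using \<open>\<theta> > 0\<close> by (simp add: T_def)
    have hit: "relax \<theta> m1 (q 0) T = c"
      unfolding T_def by (rule relax_hit) (use \<open>\<theta> > 0\<close> ge_1 in linarith)+
    have "q T = c"
      using above[of 0 T] hit \<open>T \<ge> 0\<close> that by simp
    have "q t = relax \<theta> m1 (q 0) t" if "t \<le> T"
      using above[of 0 t] relax_ge_between[of \<theta> t T c "q 0" m1] that \<open>t \<ge> 0\<close> \<open>\<theta> > 0\<close> \<open>c < q 0\<close> hit
      by simp
    \<comment> \<open>The second phase starts exactly at \<open>c\<close> and heads for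
      \<open>m0 \<le> c\<close>, so it never crosses back.\<close>
    moreover have "q t = relax \<mu> m0 c (t - T)" if "T < t"
      using below[of T t] relax_le[of \<mu> "t - T" c c m0] that \<open>T \<ge> 0\<close> \<open>\<mu> > 0\<close> \<open>q T = c\<close>
        \<open>lam < \<mu> * c\<close> by (simp add: m0_le)
    ultimately show ?thesis
      by (simp add: T)
  qed

  have up: "(t \<le> t2_star lam \<mu> c (q 0) \<longrightarrow> q t = relax \<mu> m0 (q 0) t) \<and>
      (t > t2_star lam \<mu> c (q 0) \<longrightarrow> q t = relax \<theta> m1 c (t - t2_star lam \<mu> c (q 0)))"
    if "q 0 \<le> c" "\<mu> * c < lam"
  proof -
    define T where "T = t2_star lam \<mu> c (q 0)"
    have T: "T = 1 / \<mu> * ln ((q 0 - m0) / (c - m0))"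
      by (simp add: T_def t2_star_def m0_def)
    have "c < m0"
      using that by (simp add: m0_less)
    \<comment> \<open>Here both differences are negative, with
      \<open>q 0 - m0 \<le> c - m0 < 0\<close>. If \<open>q 0 = c\<close>, the ratio is 1 and the
      first phase has length 0.\<close>
    then have ge_1: "1 \<le> (q 0 - m0) / (c - m0)"
      using that by simp
    then have "T \<ge> 0"
      using \<open>\<mu> > 0\<close> by (simp add: T)
    have hit: "relax \<mu> m0 (q 0) T = c"
      unfolding T by (rule relax_hit) (use \<open>\<mu> > 0\<close> ge_1 in linarith)+
    have "q T = c"
      using below[of 0 T] hit \<open>T \<ge> 0\<close> that by simp
    have "q t = relax \<mu> m0 (q 0) t" if "t \<le> T"
      using below[of 0 t] relax_le_between[of \<mu> t T "q 0" c m0] that \<open>t \<ge> 0\<close> \<open>\<mu> > 0\<close> \<open>q 0 \<le> c\<close> hit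
      by simp
    moreover have "q t = relax \<theta> m1 c (t - T)" if "T < t"
      using above[of T t] relax_ge[of \<theta> "t - T" c c m1] that \<open>T \<ge> 0\<close> \<open>\<theta> > 0\<close> \<open>q T = c\<close>
        \<open>\<mu> * c < lam\<close> by (simp add: m1_ge)
    ultimately show ?thesis
      by (simp add: T_def)
  qed

  have "c - m1 = (- lam + \<mu> * c) / \<theta>"
    using \<open>\<theta> > 0\<close> by (simp add: m1_def field_simps)
  then have relax_m1_c: "relax \<theta> m1 c s = m1 + (- lam + \<mu> * c) / \<theta> * exp (- \<theta> * s)" for s
    by (simp only: relax_def)
  \<comment> \<open>An infinite switching time makes the case after \<open>t1_star\<close> vacuous
    at critical loading, and \<open>above_forever\<close> covers the case before it.\<close>
  have critical: "t1_star lam \<mu> \<theta> c (q 0) = \<infinity>" if "lam = \<mu> * c"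
    using that by (simp add: t1_star_def)
  show ?thesis
    unfolding m1_def[symmetric] m0_def[symmetric] relax_m1_c[symmetric] relax_def[symmetric]
    using above_forever below_forever down up critical
    by (cases lam "\<mu> * c" rule: linorder_cases) auto
qed

end
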